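(* For any real numbers $i,j>0$ satisfying $i+j=1$ and any vector $\mathbf{x}=(x_1,x_2)\in\mathbf{Bad}(i,j)$, the set $\mathbf{Bad}_{\mathbf{x}}(i,j)$ is $1/2$ winning.
   Context: Notation: $\|x\|$ is the distance from the real number $x$ to the nearest integer. For real $i,j>0$ with $i+j=1$, $$\mathbf{Bad}(i,j)=\left\{(x_1,x_2)\in[0,1)^2:\ \inf_{q\in\mathbb{Z}\setminus\{0\}}\max\left\{|q|^{i}\|qx_1\|,\ |q|^{j}\|qx_2\|\right\}>0\right\},$$ and for $\mathbf{x}=(x_1,x_2)$, $$\mathbf{Bad}_{\mathbf{x}}(i,j)=\left\{(\alpha_1,\alpha_2)\in[0,1)^2:\ \inf_{q\in\mathbb{Z}\setminus\{0\}}\max\left\{|q|^{i}\|qx_1-\alpha_1\|,\ |q|^{j}\|qx_2-\alpha_2\|\right\}>0\right\}.$$ Winning sets (in the sense of Schmidt): for $a,b\in(0,1)$ and $S\subseteq\mathbb{R}^n$ (here $n=2$), the $(a,b)$-game is played by Bob and Alice. Bob chooses a closed Euclidean ball $B_1\subset\mathbb{R}^n$ of positive radius; Alice chooses a closed ball $A_1\subset B_1$ of radius $a$ times that of $B_1$; Bob chooses a closed ball $B_2\subset A_1$ of radius $b$ times that of $A_1$; and so on. Alice wins if the unique point of $\bigcap_r B_r$ lies in $S$. The set $S$ is $(a,b)$-winning if Alice has a winning strategy, and $S$ is $a$ winning if it is $(a,b)$-winning for every $b\in(0,1)$. A subset of $[0,1)^n$ defined by a condition invariant under $\mathbb{Z}^n$-translations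 of $\boldsymbol\alpha$ (as here) is regarded modulo $\mathbb{Z}^n$: it is called $a$ winning if the set of all $\boldsymbol\alpha\in\mathbb{R}^n$ satisfying the same condition is $a$ winning. *)

theory Defs
  imports "HOL-Analysis.Analysis"
begin

section \<open>Schmidt's game\<close>

text \<open>
  A closed ball is represented by its centre and radius; in a nontrivial Euclidean space a
  closed ball of positive radius determines both.
\<close>

type_synonym 'a cball_rep = "'a \<times> real"

definition ball_set :: "'a::metric_space cball_rep \<Rightarrow> 'a set" where
  "ball_set B = cball (fst B) (snd B)"

definition legal_move :: "real \<Rightarrow> 'a::metric_space cball_rep \<Rightarrow> 'a cball_rep \<Rightarrow> bool" where
  "legal_move c B B' \<longleftrightarrow> snd B' = c * snd B \<and> ball_set B' \<subseteq> ball_set B"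

text \<open>
  A strategy for Alice maps the list of all balls Bob has chosen so far to her next ball. Her own
  earlier balls are determined by the strategy and this list. Rounds are counted from 0.
\<close>

type_synonym 'a strategy = "'a cball_rep list \<Rightarrow> 'a cball_rep"

definition reply :: "'a strategy \<Rightarrow> (nat \<Rightarrow> 'a cball_rep) \<Rightarrow> nat \<Rightarrow> 'a cball_rep" where
  "reply \<sigma> B n = \<sigma> (map B [0..<Suc n])"

definition bob_legal ::
  "real \<Rightarrow> 'a::metric_space strategy \<Rightarrow> (nat \<Rightarrow> 'a cball_rep) \<Rightarrow> nat \<Rightarrow> bool" where
  "bob_legal b \<sigma> B n \<longleftrightarrow>
     0 < snd (B 0) \<and> (\<forall>m<n. legal_move b (reply \<sigma> B m) (B (Suc m)))"

text \<open>
  Legality of Alice's reply is required after every finite legal sequence of moves of Bob. Demanding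
  it only along infinite plays would let Alice win by making a move that Bob cannot answer.
\<close>

definition winning_strategy ::
  "real \<Rightarrow> real \<Rightarrow> 'a::metric_space set \<Rightarrow> 'a strategy \<Rightarrow> bool" where
  "winning_strategy a b S \<sigma> \<longleftrightarrow>
     (\<forall>B n. bob_legal b \<sigma> B n \<longrightarrow> legal_move a (B n) (reply \<sigma> B n)) \<and>
     (\<forall>B. (\<forall>n. bob_legal b \<sigma> B n) \<longrightarrow> (\<exists>p\<in>S. (\<Inter>n. ball_set (B n)) = {p}))"

definition game_winning :: "real \<Rightarrow> real \<Rightarrow> 'a::euclidean_space set \<Rightarrow> bool" where
  "game_winning a b S \<longleftrightarrow> (\<exists>\<sigma>. winning_strategy a b S \<sigma>)"

definition winning :: "real \<Rightarrow> 'a::euclidean_space set \<Rightarrow> bool" where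
  "winning a S \<longleftrightarrow> (\<forall>b. 0 < b \<and> b < 1 \<longrightarrow> game_winning a b S)"

definition periodic_ext :: "(real \<times> real) set \<Rightarrow> (real \<times> real) set" where
  "periodic_ext S = {(s + of_int m, t + of_int n) | s t m n. (s, t) \<in> S}"

text \<open>
  Subsets of the unit square are regarded modulo the integer lattice; such a set is winning if
  its lift to the plane is.
\<close>

definition winning_mod1 :: "real \<Rightarrow> (real \<times> real) set \<Rightarrow> bool" where
  "winning_mod1 a S \<longleftrightarrow> winning a (periodic_ext S)"

section \<open>Badly approximable pairs\<close>

definition dist_int :: "real \<Rightarrow> real" where
  "dist_int x = \<bar>x - of_int (round x)\<bar>"

definition Bad :: "real \<Rightarrow> real \<Rightarrow> (real \<times> real) set" where
  "Bad i j = {(x\<^sub>1, x\<^sub>2) \<in> {0..<1} \<times> {0..<1}.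
     (INF q\<in>UNIV - {0::int}.
        max (\<bar>of_int q\<bar> powr i * dist_int (of_int q * x\<^sub>1))
            (\<bar>of_int q\<bar> powr j * dist_int (of_int q * x\<^sub>2))) > 0}"

definition inhom_bad_cond :: "real \<Rightarrow> real \<Rightarrow> real \<times> real \<Rightarrow> real \<times> real \<Rightarrow> bool" where
  "inhom_bad_cond i j x \<alpha> \<longleftrightarrow>
     (INF q\<in>UNIV - {0::int}.
        max (\<bar>of_int q\<bar> powr i * dist_int (of_int q * fst x - fst \<alpha>))
            (\<bar>of_int q\<bar> powr j * dist_int (of_int q * snd x - snd \<alpha>))) > 0"

definition Bad_inhom :: "real \<Rightarrow> real \<Rightarrow> real \<times> real \<Rightarrow> (real \<times> real) set" where
  "Bad_inhom i j x = {\<alpha> \<in> {0..<1} \<times> {0..<1}. inhom_bad_cond i j x \<alpha>}"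

text \<open>
  The lift of the inhomogeneous set consists of all points of the plane satisfying the same
  condition.
\<close>

lemma dist_int_diff_of_int: "dist_int (x - (y + of_int n)) = dist_int (x - y)"
proof -
  have "round (x - (y + of_int n)) = round (x - y) - n"
    unfolding round_def by linarith
  then show ?thesis by (simp add: dist_int_def)
qed

lemma inhom_bad_cond_periodic:
  "inhom_bad_cond i j x (s + of_int m, t + of_int n) \<longleftrightarrow> inhom_bad_cond i j x (s, t)"
  by (simp add: inhom_bad_cond_def dist_int_diff_of_int)

lemma periodic_ext_Bad_inhom:
  "periodic_ext (Bad_inhom i j x) = {\<alpha>. inhom_bad_cond i j x \<alpha>}"
proof (intro set_eqI iffI)
  fix \<alpha> assume "\<alpha> \<in> periodic_ext (Bad_inhom i j x)"
  then show "\<alpha> \<in> {\<alpha>. inhom_bad_cond i j x \<alpha>}"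
    by (auto simp: periodic_ext_def Bad_inhom_def inhom_bad_cond_periodic)
next
  fix \<alpha> assume A: "\<alpha> \<in> {\<alpha>. inhom_bad_cond i j x \<alpha>}"
  obtain u v where uv: "\<alpha> = (u, v)" by fastforce
  have eq: "\<alpha> = (frac u + of_int \<lfloor>u\<rfloor>, frac v + of_int \<lfloor>v\<rfloor>)"
    by (simp add: uv frac_def)
  have "inhom_bad_cond i j x (frac u, frac v)"
    using A by (simp add: eq inhom_bad_cond_periodic)
  then have "(frac u, frac v) \<in> Bad_inhom i j x"
    by (simp add: Bad_inhom_def frac_lt_1)
  then show "\<alpha> \<in> periodic_ext (Bad_inhom i j x)"
    unfolding periodic_ext_def using eq by blast
qed

end

theory Submission
  imports Defs
begin

text \<open>
  Fix \<open>R > 1\<close> and consider the boxes of half side lengths \<open>\<epsilon> \<bar>q\<bar> powr -i\<close> and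
  \<open>\<epsilon> \<bar>q\<bar> powr -j\<close> around the translates of \<open>q x\<close> with \<open>R ^ n \<le> \<bar>q\<bar> < R ^ Suc n\<close>.
  The difference of two such centres is a translate of \<open>(q - q') x\<close>, so
  \<open>x \<in> Bad i j\<close> separates them, and a ball of radius a small multiple of
  \<open>R powr (- n * max i j)\<close> meets at most one of these boxes. That box lies in a thin strip
  around an axis-parallel line, and in two rounds Alice can escape from a thin strip: moving
  twice as far as possible away from its central line leaves a gap as large as Bob's second ball.
  Choosing \<open>R\<close> such that two rounds shrink the radius by \<open>R powr (- max i j)\<close>, she deals with the
  \<open>n\<close>-th range of \<open>q\<close> in the \<open>n\<close>-th pair of rounds, counted from when the radius is small enough.
\<close>

section \<open>Escaping from neighbourhoods of hyperplanes\<close>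

text \<open>The ball moves away from the hyperplane \<open>p \<bullet> v = l\<close> as far as
  legality permits: the new ball touches the old one from inside.\<close>

definition escape_move :: "'a::euclidean_space \<Rightarrow> real \<Rightarrow> 'a cball_rep \<Rightarrow> 'a cball_rep" where
  "escape_move v l B =
     (fst B + ((if l \<le> fst B \<bullet> v then 1 else -1) * (snd B / 2)) *\<^sub>R v, snd B / 2)"

lemma legal_move_escape_move:
  assumes "norm v = 1" "0 < snd B"
  shows "legal_move (1/2) B (escape_move v l B)"
  using assms by (auto simp: legal_move_def ball_set_def escape_move_def cball_subset_cball_iff dist_norm)

lemma inner_diff_le_dist:
  fixes v :: "'a::real_inner"
  assumes "norm v = 1"
  shows "\<bar>p \<bullet> v - z \<bullet> v\<bar> \<le> dist p z"
  using Cauchy_Schwarz_ineq2[of "p - z" v] assms by (simp add: inner_diff_left dist_norm)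

text \<open>Measure heights above the hyperplane, with \<open>z\<close> at height at least 0.
  Alice's first ball is centred at height at least \<open>r / 2\<close>, so the centre
  \<open>z'\<close> of Bob's ball inside it has height at least \<open>r'\<close>. Her second move
  therefore goes the same way, to height at least \<open>3 * r' / 2\<close>, and its radius
  \<open>r' / 2\<close> leaves \<open>r'\<close>. The other side is symmetric.\<close>

lemma escape_move_twice:
  fixes v :: "'a::euclidean_space"
  assumes v: "norm v = 1" and r: "0 < snd B" "0 < b"
    and B': "legal_move b (escape_move v l B) B'"
    and p: "p \<in> ball_set (escape_move v l B')"
  shows "snd B' \<le> \<bar>p \<bullet> v - l\<bar>"
proof -
  obtain z r where B: "B = (z, r)" by fastforce
  obtain z' r' where B'': "B' = (z', r')" by fastforce
  have vv: "v \<bullet> v = 1" using v by (simp add: norm_eq_1)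
  have "r' = b * (r / 2)"
    using B' by (simp add: legal_move_def escape_move_def B B'')
  moreover have "0 < b * (r / 2)" using r by (simp add: B)
  ultimately have r': "0 < r'" by simp
  define s :: real where "s = (if l \<le> z \<bullet> v then 1 else -1)"
  define s' :: real where "s' = (if l \<le> z' \<bullet> v then 1 else -1)"
  have "dist z' (z + (s * (r / 2)) *\<^sub>R v) \<le> r / 2 - r'"
    using B' r r' by (auto simp: legal_move_def ball_set_def escape_move_def B B'' s_def
        cball_subset_cball_iff)
  then have 1: "\<bar>z' \<bullet> v - (z \<bullet> v + s * (r / 2))\<bar> \<le> r / 2 - r'"
    using inner_diff_le_dist[OF v, of z' "z + (s * (r / 2)) *\<^sub>R v"]
    by (simp add: inner_add_left vv)
  have "dist p (z' + (s' * (r' / 2)) *\<^sub>R v) \<le> r' / 2"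
    using p by (simp add: ball_set_def escape_move_def B'' s'_def dist_commute)
  then have 2: "\<bar>p \<bullet> v - (z' \<bullet> v + s' * (r' / 2))\<bar> \<le> r' / 2"
    using inner_diff_le_dist[OF v, of p "z' + (s' * (r' / 2)) *\<^sub>R v"]
    by (simp add: inner_add_left vv)
  show ?thesis
    using 1 2 r' by (auto simp: B'' s_def s'_def abs_le_iff abs_if split: if_splits)
qed

section \<open>Limit points of plays and the strategy of double escapes\<close>

lemma nested_balls_singleton:
  fixes B :: "nat \<Rightarrow> 'a::euclidean_space cball_rep"
  assumes sub: "\<And>n. ball_set (B (Suc n)) \<subseteq> ball_set (B n)"
    and rad: "\<And>n. snd (B n) = \<rho> * c ^ n" and "0 < \<rho>" "0 < c" "c < 1"
  shows "\<exists>p. (\<Inter>n. ball_set (B n)) = {p}"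
proof -
  have "\<exists>n. \<forall>x\<in>ball_set (B n). \<forall>y\<in>ball_set (B n). dist x y < e" if "e > 0" for e
  proof -
    have "e / (2 * \<rho>) > 0" using that \<open>0 < \<rho>\<close> by simp
    then obtain n where "c ^ n < e / (2 * \<rho>)"
      using real_arch_pow_inv \<open>c < 1\<close> by blast
    then have n: "2 * (\<rho> * c ^ n) < e" using \<open>0 < \<rho>\<close> by (simp add: field_simps)
    have "dist x y < e" if "x \<in> ball_set (B n)" "y \<in> ball_set (B n)" for x y
    proof -
      have "dist (fst (B n)) x \<le> \<rho> * c ^ n" "dist (fst (B n)) y \<le> \<rho> * c ^ n"
        using that by (simp_all add: ball_set_def rad)
      then show ?thesis
        using n dist_triangle2[of x y "fst (B n)"] by (simp add: dist_commute)
    qed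
    then show ?thesis by blast
  qed
  moreover have "ball_set (B n) \<subseteq> ball_set (B m)" if "m \<le> n" for m n
    using lift_Suc_antimono_le[of "\<lambda>n. ball_set (B n)"] sub that by blast
  moreover have "ball_set (B n) \<noteq> {}" for n
    using \<open>0 < \<rho>\<close> \<open>0 < c\<close> by (simp add: ball_set_def rad not_less)
  moreover have "closed (ball_set (B n))" for n
    by (simp add: ball_set_def)
  ultimately show ?thesis
    using decreasing_closed_nest_sing[of "\<lambda>n. ball_set (B n)"] by metis
qed

text \<open>
  Here \<open>z k\<close> is the centre of Bob's ball at the beginning of the \<open>k\<close>-th pair of rounds, \<open>\<rho>\<close> is his
  initial radius, and \<open>{p. p \<bullet> v = L k (z k)}\<close> is the hyperplane that Alice avoids in that pair.
\<close>

lemma game_winning_half_if_strips: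
  fixes v :: "'a::euclidean_space" and S :: "'a set"
  assumes v: "norm v = 1" and b: "0 < b" "b < 1"
    and strips: "\<And>\<rho>. 0 < \<rho> \<Longrightarrow> \<exists>L. \<forall>z p.
      (\<forall>k. dist (z k) p \<le> \<rho> * (b/2) ^ (2*k)) \<longrightarrow>
      (\<forall>k::nat. \<rho> * (b/2) ^ Suc (2*k) \<le> \<bar>p \<bullet> v - L k (z k)\<bar>) \<longrightarrow> p \<in> S"
  shows "game_winning (1/2) b S"
proof -
  \<comment> \<open>The strategy has to work for every initial radius, so the hyperplanes are chosen
    as a function of \<open>\<rho>\<close>, which is read off Bob's first ball.\<close>
  obtain L where L: "\<And>\<rho> z p. \<lbrakk>0 < \<rho>; \<And>k. dist (z k) p \<le> \<rho> * (b/2) ^ (2*k);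
      \<And>k::nat. \<rho> * (b/2) ^ Suc (2*k) \<le> \<bar>p \<bullet> v - L \<rho> k (z k)\<bar>\<rbrakk> \<Longrightarrow> p \<in> S"
    using strips by metis
  \<comment> \<open>\<open>length Bs - 1\<close> is the current round. Both rounds of pair
    \<open>k\<close> use Bob's centre at round \<open>2*k\<close>, so that the two moves flee from
    the same hyperplane.\<close>
  define \<sigma> :: "'a strategy" where "\<sigma> = (\<lambda>Bs. let k = (length Bs - 1) div 2 in
    escape_move v (L (snd (Bs ! 0)) k (fst (Bs ! (2*k)))) (last Bs))"
  have reply: "reply \<sigma> B n =
      escape_move v (L (snd (B 0)) (n div 2) (fst (B (2 * (n div 2))))) (B n)" for B n
  proof -
    have "map B [0..<Suc n] ! m = B m" if "m \<le> n" for m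
      using that by (simp del: upt_Suc)
    from this[of 0] this[of "2 * (n div 2)"] show ?thesis
      by (simp add: reply_def \<sigma>_def Let_def del: upt_Suc) simp
  qed
  have radius: "snd (B m) = snd (B 0) * (b/2) ^ m" if "bob_legal b \<sigma> B n" "m \<le> n" for B n m
    using that(2)
  proof (induction m)
    case (Suc m)
    then have "legal_move b (reply \<sigma> B m) (B (Suc m))"
      using that(1) by (simp add: bob_legal_def)
    then show ?case
      using Suc by (simp add: legal_move_def reply escape_move_def)
  qed simp
  have legal: "legal_move (1/2) (B n) (reply \<sigma> B n)" if "bob_legal b \<sigma> B n" for B n
  proof -
    have "0 < snd (B n)"
      using that radius[OF that, of n] b by (simp add: bob_legal_def)
    then show ?thesis
      unfolding reply by (rule legal_move_escape_move[OF v])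
  qed
  have "\<exists>p\<in>S. (\<Inter>n. ball_set (B n)) = {p}" if all: "\<And>n. bob_legal b \<sigma> B n" for B
  proof -
    define \<rho> where "\<rho> = snd (B 0)"
    have \<rho>: "0 < \<rho>" using all[of 0] by (simp add: bob_legal_def \<rho>_def)
    have rad: "snd (B n) = \<rho> * (b/2) ^ n" for n
      using radius[OF all, of n n] by (simp add: \<rho>_def)
    have pos: "0 < snd (B n)" for n using rad \<rho> b by simp
    have bob: "legal_move b (reply \<sigma> B n) (B (Suc n))" for n
      using all[of "Suc n"] by (simp add: bob_legal_def)
    have sub: "ball_set (B (Suc n)) \<subseteq> ball_set (reply \<sigma> B n)"
      "ball_set (reply \<sigma> B n) \<subseteq> ball_set (B n)" for n
      using bob[of n] legal[OF all[of n]] by (auto simp: legal_move_def)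
    obtain p where p: "(\<Inter>n. ball_set (B n)) = {p}"
      using nested_balls_singleton[of B \<rho> "b/2"] sub rad \<rho> b by force
    then have pB: "p \<in> ball_set (B n)" for n by blast
    have "p \<in> S"
    proof (rule L[OF \<rho>])
      fix k
      show "dist (fst (B (2*k))) p \<le> \<rho> * (b/2) ^ (2*k)"
        using pB[of "2*k"] by (simp add: ball_set_def rad)
    next
      fix k :: nat
      have "snd (B (Suc (2*k))) \<le> \<bar>p \<bullet> v - L \<rho> k (fst (B (2*k)))\<bar>"
      proof (rule escape_move_twice[OF v pos \<open>0 < b\<close>])
        show "legal_move b (escape_move v (L \<rho> k (fst (B (2*k)))) (B (2*k))) (B (Suc (2*k)))"
          using bob[of "2*k"] by (simp add: reply \<rho>_def)
        have "p \<in> ball_set (reply \<sigma> B (Suc (2*k)))"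
          using pB sub(1) by blast
        then show "p \<in> ball_set (escape_move v (L \<rho> k (fst (B (2*k)))) (B (Suc (2*k))))"
          by (simp add: reply \<rho>_def)
      qed
      then show "\<rho> * (b/2) ^ Suc (2*k) \<le> \<bar>p \<bullet> v - L \<rho> k (fst (B (2*k)))\<bar>"
        by (simp only: rad)
    qed
    then show ?thesis using p by blast
  qed
  then show ?thesis
    unfolding game_winning_def winning_strategy_def using legal by blast
qed

section \<open>Boxes around the multiples of a badly approximable pair\<close>

lemma dist_int_le: "dist_int x \<le> \<bar>x - of_int m\<bar>"
  unfolding dist_int_def using round_diff_minimal[of x m] by simp

lemma le_powr_mult_iff:
  fixes q :: int and c s y :: real
  assumes "q \<noteq> 0"
  shows "c \<le> \<bar>of_int q\<bar> powr s * y \<longleftrightarrow> c * \<bar>of_int q\<bar> powr (-s) \<le> y"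
proof -
  have "0 < \<bar>of_int q :: real\<bar> powr s" using assms by simp
  then show ?thesis by (simp add: powr_minus field_simps)
qed

lemma BadE:
  assumes "(x1, x2) \<in> Bad i j"
  obtains c where "0 < c" "c \<le> 1"
    "\<And>q m n :: int. q \<noteq> 0 \<Longrightarrow> c * \<bar>of_int q\<bar> powr (-i) \<le> \<bar>of_int q * x1 - of_int m\<bar> \<or>
       c * \<bar>of_int q\<bar> powr (-j) \<le> \<bar>of_int q * x2 - of_int n\<bar>"
proof -
  define f where "f q = max (\<bar>of_int q\<bar> powr i * dist_int (of_int q * x1))
    (\<bar>of_int q\<bar> powr j * dist_int (of_int q * x2))" for q :: int
  \<comment> \<open>The cap at 1 later forces integer differences in \<open>at_most_one_box\<close>
    below 1.\<close>
  define c where "c = min 1 (INF q\<in>UNIV - {0}. f q)"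
  show ?thesis
  proof
    show "0 < c" "c \<le> 1"
      using assms by (auto simp: Bad_def c_def f_def)
    fix q m n :: int assume q: "q \<noteq> 0"
    have "bdd_below (f ` (UNIV - {0}))"
      by (rule bdd_belowI2[of _ 0]) (simp add: f_def le_max_iff_disj dist_int_def)
    then have "(INF q\<in>UNIV - {0}. f q) \<le> f q"
      using q by (intro cINF_lower) auto
    then have "c \<le> f q" by (simp add: c_def)
    then have "c * \<bar>of_int q\<bar> powr (-i) \<le> dist_int (of_int q * x1) \<or>
        c * \<bar>of_int q\<bar> powr (-j) \<le> dist_int (of_int q * x2)"
      unfolding f_def le_max_iff_disj le_powr_mult_iff[OF q] .
    then show "c * \<bar>of_int q\<bar> powr (-i) \<le> \<bar>of_int q * x1 - of_int m\<bar> \<or>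
       c * \<bar>of_int q\<bar> powr (-j) \<le> \<bar>of_int q * x2 - of_int n\<bar>"
      using dist_int_le order_trans by blast
  qed
qed

definition in_box :: "real \<Rightarrow> real \<Rightarrow> real \<times> real \<Rightarrow> real \<Rightarrow> int \<Rightarrow> int \<Rightarrow> int \<Rightarrow> real \<times> real \<Rightarrow> bool"
  where "in_box i j x \<epsilon> q m n \<alpha> \<longleftrightarrow>
    \<bar>of_int q * fst x - of_int m - fst \<alpha>\<bar> < \<epsilon> * \<bar>of_int q\<bar> powr (-i) \<and>
    \<bar>of_int q * snd x - of_int n - snd \<alpha>\<bar> < \<epsilon> * \<bar>of_int q\<bar> powr (-j)"

text \<open>The box at the nearest integers is described by \<open>dist_int\<close>, so avoiding it
  makes \<open>\<epsilon>\<close> a lower bound for each term of the infimum.\<close>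

lemma inhom_bad_condI:
  assumes "0 < \<epsilon>" and box: "\<And>q m n. q \<noteq> 0 \<Longrightarrow> \<not> in_box i j x \<epsilon> q m n \<alpha>"
  shows "inhom_bad_cond i j x \<alpha>"
proof -
  have "\<epsilon> \<le> (INF q\<in>UNIV - {0::int}.
        max (\<bar>of_int q\<bar> powr i * dist_int (of_int q * fst x - fst \<alpha>))
            (\<bar>of_int q\<bar> powr j * dist_int (of_int q * snd x - snd \<alpha>)))"
  proof (rule cINF_greatest)
    fix q :: int assume "q \<in> UNIV - {0}"
    then have q: "q \<noteq> 0" by simp
    show "\<epsilon> \<le> max (\<bar>of_int q\<bar> powr i * dist_int (of_int q * fst x - fst \<alpha>))
            (\<bar>of_int q\<bar> powr j * dist_int (of_int q * snd x - snd \<alpha>))"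
      using box[OF q, of "round (of_int q * fst x - fst \<alpha>)" "round (of_int q * snd x - snd \<alpha>)"]
      unfolding le_max_iff_disj le_powr_mult_iff[OF q] in_box_def dist_int_def
      by (simp add: algebra_simps not_less)
  next
    show "UNIV - {0::int} \<noteq> {}" using one_neq_zero by blast
  qed
  then show ?thesis
    using \<open>0 < \<epsilon>\<close> by (simp add: inhom_bad_cond_def)
qed

text \<open>Each box contributes at most \<open>r * T powr (-s)\<close>, the two points at most
  twice that, and the bound on \<open>4 * r\<close> absorbs the sum. As \<open>w\<close> dominates
  \<open>s\<close>, one \<open>r\<close> serves both coordinates.\<close>

lemma coordinate_gap:
  fixes q q' m m' :: int and s w T R c \<epsilon> r y a a' :: real
  assumes s: "0 < s" "s \<le> w" and T: "1 \<le> T" "1 \<le> R" and c: "0 < c"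
    and \<epsilon>: "0 < \<epsilon>" "\<epsilon> \<le> r" "4 * r \<le> c * (2 * R) powr (-w)"
    and q: "T \<le> \<bar>of_int q\<bar>" "\<bar>of_int q\<bar> < R * T" and q': "T \<le> \<bar>of_int q'\<bar>" "\<bar>of_int q'\<bar> < R * T"
    and a: "\<bar>of_int q * y - of_int m - a\<bar> < \<epsilon> * \<bar>of_int q\<bar> powr (-s)"
    and a': "\<bar>of_int q' * y - of_int m' - a'\<bar> < \<epsilon> * \<bar>of_int q'\<bar> powr (-s)"
    and aa': "\<bar>a - a'\<bar> \<le> 2 * r * T powr (-w)"
  shows "\<bar>of_int (q - q') * y - of_int (m - m')\<bar> < c * (2 * R * T) powr (-s)"
proof -
  have "u powr (-s) \<le> T powr (-s)" if "T \<le> u" for u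
    using that T s by (intro powr_mono2') auto
  from this[OF q(1)] this[OF q'(1)] have 1: "\<epsilon> * \<bar>of_int q\<bar> powr (-s) \<le> r * T powr (-s)" "\<epsilon> * \<bar>of_int q'\<bar> powr (-s) \<le> r * T powr (-s)"
    using \<epsilon> by (auto intro!: mult_mono)
  have "T powr (-w) \<le> T powr (-s)"
    using s T by (intro powr_mono) auto
  then have 2: "2 * r * T powr (-w) \<le> 2 * r * T powr (-s)"
    using \<epsilon> by (intro mult_left_mono) auto
  have "(2 * R) powr (-w) \<le> (2 * R) powr (-s)"
    using s T by (intro powr_mono) auto
  then have "c * (2 * R) powr (-w) \<le> c * (2 * R) powr (-s)"
    using c by (intro mult_left_mono) auto
  with \<epsilon> have "4 * r \<le> c * (2 * R) powr (-s)" by linarith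
  then have "4 * r * T powr (-s) \<le> c * (2 * R) powr (-s) * T powr (-s)"
    by (rule mult_right_mono) simp
  then have 3: "4 * r * T powr (-s) \<le> c * (2 * R * T) powr (-s)"
    using T by (simp add: powr_mult)
  have "\<bar>of_int (q - q') * y - of_int (m - m')\<bar> \<le>
    \<bar>of_int q * y - of_int m - a\<bar> + \<bar>of_int q' * y - of_int m' - a'\<bar> + \<bar>a - a'\<bar>"
    by (simp add: algebra_simps)
  then show ?thesis
    using a a' aa' 1 2 3 by linarith
qed

text \<open>Since \<open>q - q'\<close> has size at most \<open>2 * R * T\<close>, for
  \<open>q \<noteq> q'\<close> both coordinate gaps would fall below the bounds in
  \<open>bad\<close>. Once \<open>q = q'\<close>, the gaps are integers below 1. The points
  \<open>\<alpha>\<close> and \<open>\<alpha>'\<close> may differ, so this covers the whole ball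
  around \<open>z\<close>.\<close>

lemma at_most_one_box:
  assumes ij: "0 < i" "i \<le> w" "0 < j" "j \<le> w" and T: "1 \<le> T" "1 \<le> R"
    and c: "0 < c" "c \<le> 1"
    and bad: "\<And>q m n :: int. q \<noteq> 0 \<Longrightarrow>
       c * \<bar>of_int q\<bar> powr (-i) \<le> \<bar>of_int q * fst x - of_int m\<bar> \<or>
       c * \<bar>of_int q\<bar> powr (-j) \<le> \<bar>of_int q * snd x - of_int n\<bar>"
    and \<epsilon>: "0 < \<epsilon>" "\<epsilon> \<le> r" "4 * r \<le> c * (2 * R) powr (-w)"
    and q: "T \<le> \<bar>of_int q\<bar>" "\<bar>of_int q\<bar> < R * T" and q': "T \<le> \<bar>of_int q'\<bar>" "\<bar>of_int q'\<bar> < R * T"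
    and box: "in_box i j x \<epsilon> q m n \<alpha>" and box': "in_box i j x \<epsilon> q' m' n' \<alpha>'"
    and \<alpha>: "dist z \<alpha> \<le> r * T powr (-w)" and \<alpha>': "dist z \<alpha>' \<le> r * T powr (-w)"
  shows "q = q' \<and> m = m' \<and> n = n'"
proof -
  have "dist \<alpha> \<alpha>' \<le> 2 * r * T powr (-w)"
    using dist_triangle3[of \<alpha> \<alpha>' z] \<alpha> \<alpha>' by simp
  then have "\<bar>fst \<alpha> - fst \<alpha>'\<bar> \<le> 2 * r * T powr (-w)" "\<bar>snd \<alpha> - snd \<alpha>'\<bar> \<le> 2 * r * T powr (-w)"
    using dist_fst_le[of \<alpha> \<alpha>'] dist_snd_le[of \<alpha> \<alpha>'] by (simp_all add: dist_real_def)
  then have gap: "\<bar>of_int (q - q') * fst x - of_int (m - m')\<bar> < c * (2 * R * T) powr (-i)"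
    "\<bar>of_int (q - q') * snd x - of_int (n - n')\<bar> < c * (2 * R * T) powr (-j)"
    using box box' ij unfolding in_box_def
    by (metis coordinate_gap T c(1) \<epsilon> q q')+
  have "q = q'"
  proof (rule ccontr)
    assume "q \<noteq> q'"
    have le: "\<bar>of_int (q - q')\<bar> \<le> 2 * R * T" using q q' by simp
    have "(2 * R * T) powr (-s) \<le> \<bar>of_int (q - q')\<bar> powr (-s)" if "0 < s" for s
      using le that \<open>q \<noteq> q'\<close> by (intro powr_mono2') auto
    then have "c * (2 * R * T) powr (-s) \<le> c * \<bar>of_int (q - q')\<bar> powr (-s)" if "0 < s" for s
      using c that by simp
    from this[of i] this[of j] show False
      using gap bad[of "q - q'" "m - m'" "n - n'"] \<open>q \<noteq> q'\<close> ij by fastforce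
  qed
  have "1 \<le> 2 * R * T"
    using T mult_mono[of 1 R 1 T] by simp
  then have "(2 * R * T) powr (-s) \<le> 1" if "0 < s" for s
    using that powr_mono[of "-s" 0 "2 * R * T"] T by simp
  then have "c * (2 * R * T) powr (-s) \<le> 1" if "0 < s" for s
    using c that mult_mono[of c 1 "(2 * R * T) powr (-s)" 1] by simp
  from this[of i] this[of j] have "\<bar>real_of_int (m - m')\<bar> < 1" "\<bar>real_of_int (n - n')\<bar> < 1"
    using gap ij \<open>q = q'\<close> by auto
  then show ?thesis
    using \<open>q = q'\<close> by linarith
qed

section \<open>Geometric ranges of multipliers and the strips to avoid\<close>

lemma ex_power_interval:
  fixes R y :: real
  assumes "1 < R" "1 \<le> y"
  obtains n where "R ^ n \<le> y" "y < R ^ Suc n"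
proof -
  define P where "P n \<longleftrightarrow> y < R ^ n" for n
  have "\<exists>n. P n" using real_arch_pow[OF assms(1)] by (simp add: P_def)
  moreover have "\<not> P 0" using assms by (simp add: P_def)
  ultimately obtain n where "\<not> P n" "P (Suc n)"
    by (metis not0_implies_Suc LeastI_ex not_less_Least lessI)
  then show ?thesis using that by (simp add: P_def not_less)
qed

theorem corollary1p3:
  fixes i j x\<^sub>1 x\<^sub>2 :: real
  assumes "i > 0" and "j > 0" and "i + j = 1"
    and "(x\<^sub>1, x\<^sub>2) \<in> Bad i j"
  shows "winning_mod1 (1/2) (Bad_inhom i j (x\<^sub>1, x\<^sub>2))"
proof -
  define x where "x = (x\<^sub>1, x\<^sub>2)"
  obtain c where c: "0 < c" "c \<le> 1"
    and bad: "\<And>q m n :: int. q \<noteq> 0 \<Longrightarrow>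
       c * \<bar>of_int q\<bar> powr (-i) \<le> \<bar>of_int q * fst x - of_int m\<bar> \<or>
       c * \<bar>of_int q\<bar> powr (-j) \<le> \<bar>of_int q * snd x - of_int n\<bar>"
    using BadE[OF assms(4)] unfolding x_def fst_conv snd_conv by metis
  \<comment> \<open>\<open>w\<close> is the larger exponent and \<open>v\<close> the axis along
    which boxes are thin; \<open>proj\<close> puts a box into a strip around the line through its
    centre orthogonal to \<open>v\<close>.\<close>
  obtain v :: "real \<times> real" and w where v: "norm v = 1" and w: "i \<le> w" "j \<le> w" "0 < w"
    and proj: "\<And>\<epsilon> q m n \<alpha>. in_box i j x \<epsilon> q m n \<alpha> \<Longrightarrow>
      \<bar>\<alpha> \<bullet> v - (of_int q * fst x - of_int m, of_int q * snd x - of_int n) \<bullet> v\<bar>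
        < \<epsilon> * \<bar>of_int q\<bar> powr (-w)"
  proof (cases "i \<le> j")
    case True
    then show ?thesis
      using assms by (intro that[of "(0, 1)" j]) (auto simp: in_box_def inner_prod_def norm_Pair abs_minus_commute)
  next
    case False
    then show ?thesis
      using assms by (intro that[of "(1, 0)" i]) (auto simp: in_box_def inner_prod_def norm_Pair abs_minus_commute)
  qed
  have "game_winning (1/2) b {\<alpha>. inhom_bad_cond i j x \<alpha>}" if b: "0 < b" "b < 1" for b
  proof (rule game_winning_half_if_strips[OF v b])
    fix \<rho> :: real assume \<rho>: "0 < \<rho>"
    define \<beta> where "\<beta> = b / 2"
    have \<beta>: "0 < \<beta>" "\<beta> < 1" using b by (simp_all add: \<beta>_def)
    define R where "R = \<beta> powr (-2/w)"
    have R: "1 < R"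
      using \<beta> w powr_less_mono2_neg[of "-2/w" \<beta> 1] by (simp add: R_def)
    have "R powr (-w) = \<beta>\<^sup>2"
      using \<beta> w by (simp add: R_def powr_powr powr_numeral)
    moreover have "(R ^ n) powr (-w) = (R powr (-w)) ^ n" for n
      by (induction n) (use R in \<open>simp_all add: powr_mult\<close>)
    ultimately have Rpow: "(R ^ n) powr (-w) = \<beta> ^ (2*n)" for n
      by (simp add: power_mult)
    \<comment> \<open>After \<open>N\<close> pairs of rounds Bob's radius \<open>r\<close> is small
      enough for \<open>at_most_one_box\<close>.\<close>
    have "0 < c * (2 * R) powr (-w) / (4 * \<rho>)" using c R \<rho> by simp
    then obtain N where "\<beta> ^ N < c * (2 * R) powr (-w) / (4 * \<rho>)"
      using real_arch_pow_inv \<beta>(2) by blast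
    moreover have "\<beta> ^ (2*N) \<le> \<beta> ^ N"
      using \<beta> by (intro power_decreasing) auto
    ultimately have N: "\<beta> ^ (2*N) \<le> c * (2 * R) powr (-w) / (4 * \<rho>)" by linarith
    define r where "r = \<rho> * \<beta> ^ (2*N)"
    have r: "0 < r" "4 * r \<le> c * (2 * R) powr (-w)"
      using N \<rho> \<beta> by (simp_all add: r_def field_simps)
    \<comment> \<open>\<open>\<beta> * r\<close> is Bob's radius one round after \<open>r\<close>,
      the gap that \<open>escape_move_twice\<close> secures in pair \<open>N\<close>. In pair
      \<open>n + N\<close> both scale by \<open>(R ^ n) powr (-w)\<close>.\<close>
    define \<epsilon> where "\<epsilon> = \<beta> * r"
    have \<epsilon>: "0 < \<epsilon>" "\<epsilon> \<le> r"
      using \<beta> r by (simp_all add: \<epsilon>_def)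
    have radius: "\<rho> * \<beta> ^ (2 * (n + N)) = r * (R ^ n) powr (-w)" for n
      by (simp add: Rpow r_def distrib_left power_add)
    define strip where "strip n z l \<longleftrightarrow> (\<forall>p q m m'. dist z p \<le> r * (R ^ n) powr (-w) \<longrightarrow>
        R ^ n \<le> \<bar>of_int q\<bar> \<longrightarrow> \<bar>of_int q\<bar> < R ^ Suc n \<longrightarrow> in_box i j x \<epsilon> q m m' p \<longrightarrow>
        \<bar>p \<bullet> v - l\<bar> < \<epsilon> * (R ^ n) powr (-w))" for n z l
    have "\<exists>l. strip n z l" for n z
    proof -
      define H where "H p q m m' \<longleftrightarrow> dist z p \<le> r * (R ^ n) powr (-w) \<and>
        R ^ n \<le> \<bar>of_int q\<bar> \<and> \<bar>of_int q\<bar> < R * R ^ n \<and> in_box i j x \<epsilon> q m m' p" for p and q m m' :: int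
      show ?thesis
      \<comment> \<open>If some box of this range meets the ball, it is the only one, and
        \<open>l\<close> is the \<open>v\<close>-coordinate of its centre. Otherwise any
        \<open>l\<close> will do.\<close>
      proof (cases "\<exists>p q m m'. H p q m m'")
        case True
        then obtain p0 q0 m0 m0' where H0: "H p0 q0 m0 m0'" by blast
        define l where "l = (of_int q0 * fst x - of_int m0, of_int q0 * snd x - of_int m0') \<bullet> v"
        have "\<bar>p \<bullet> v - l\<bar> < \<epsilon> * (R ^ n) powr (-w)" if "H p q m m'" for p q m m'
        proof -
          have "1 \<le> R ^ n" using R by simp
          then have "q = q0 \<and> m = m0 \<and> m' = m0'"
            using at_most_one_box[OF assms(1) w(1) assms(2) w(2) \<open>1 \<le> R ^ n\<close> less_imp_le[OF R]
                c bad \<epsilon> r(2)] H0 that unfolding H_def by blast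
          then have "\<bar>p \<bullet> v - l\<bar> < \<epsilon> * \<bar>of_int q\<bar> powr (-w)"
            using that proj unfolding H_def l_def by blast
          also have "\<dots> \<le> \<epsilon> * (R ^ n) powr (-w)"
            using that \<epsilon> w R by (intro mult_left_mono powr_mono2') (auto simp: H_def)
          finally show ?thesis .
        qed
        then show ?thesis unfolding H_def strip_def power_Suc by blast
      qed (auto simp: H_def strip_def)
    qed
    then obtain l where l: "\<And>n z. strip n z (l n z)"
      by metis
    show "\<exists>L. \<forall>z p. (\<forall>k. dist (z k) p \<le> \<rho> * (b/2) ^ (2*k)) \<longrightarrow>
      (\<forall>k::nat. \<rho> * (b/2) ^ Suc (2*k) \<le> \<bar>p \<bullet> v - L k (z k)\<bar>) \<longrightarrow>
      p \<in> {\<alpha>. inhom_bad_cond i j x \<alpha>}"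
    proof (intro exI allI impI CollectI)
      fix z p
      \<comment> \<open>\<open>far\<close> fixes the witness \<open>L k = l (k - N)\<close>.
        Subtraction truncates, so the first \<open>N\<close> pairs use the lines for
        \<open>n = 0\<close> as placeholders while the radius shrinks.\<close>
      assume near: "\<forall>k. dist (z k) p \<le> \<rho> * (b/2) ^ (2*k)"
        and far: "\<forall>k. \<rho> * (b/2) ^ Suc (2*k) \<le> \<bar>p \<bullet> v - l (k - N) (z k)\<bar>"
      show "inhom_bad_cond i j x p"
      proof (rule inhom_bad_condI[OF \<epsilon>(1)])
        fix q m m' :: int assume "q \<noteq> 0"
        then have "1 \<le> \<bar>of_int q :: real\<bar>" by linarith
        then obtain n where n: "R ^ n \<le> \<bar>of_int q\<bar>" "\<bar>of_int q\<bar> < R ^ Suc n"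
          using ex_power_interval[OF R] by blast
        have "\<rho> * \<beta> ^ Suc (2 * (n + N)) = \<epsilon> * (R ^ n) powr (-w)"
          using radius[of n] by (simp add: \<epsilon>_def)
        then have "\<epsilon> * (R ^ n) powr (-w) \<le> \<bar>p \<bullet> v - l n (z (n + N))\<bar>"
          using far[rule_format, of "n + N"] by (simp add: \<beta>_def)
        moreover have "dist (z (n + N)) p \<le> r * (R ^ n) powr (-w)"
          using near[rule_format, of "n + N"] radius[of n] by (simp add: \<beta>_def)
        ultimately show "\<not> in_box i j x \<epsilon> q m m' p"
          using l[of n "z (n + N)"] n unfolding strip_def by fastforce
      qed
    qed
  qed
  then show ?thesis
    by (simp add: winning_mod1_def winning_def periodic_ext_Bad_inhom x_def)
qed

end
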